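(* There exists a length-preserving bijection $\psi: \mathrm{Av}(231\mid 21) \rightarrow \mathrm{Av}(321\mid 21)$.
   Context: Permutations are written in one-line notation. A permutation (or a sequence of distinct integers) contains a permutation $\tau$ of length $k$ as a pattern if it has a (not necessarily contiguous) subsequence of length $k$ whose entries are in the same relative order as those of $\tau$; otherwise it avoids $\tau$. For a permutation $\alpha$ of length three and a permutation $\beta$ of length two, the juxtaposition class $\mathrm{Av}(\alpha\mid\beta)$ is the set of all permutations $\pi$ (of any finite length) whose one-line notation can be written as a concatenation $\pi = AB$ of two (possibly empty) contiguous blocks, such that the prefix $A$ avoids $\alpha$ and the suffix $B$ avoids $\beta$. A map between sets of permutations is length-preserving if it maps each permutation of length $n$ to a permutation of length $n$, for every $n$. *)

theory Defs
  imports Main "HOL-Library.Sublist" "HOL-Combinatorics.Multiset_Permutations"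
begin

(* One-line notation: a permutation of length n is a list containing each of 1, ..., n exactly once. *)
definition is_permutation :: "nat list \<Rightarrow> bool" where
  "is_permutation p \<longleftrightarrow> p \<in> permutations_of_set {1..length p}"

definition order_isomorphic :: "nat list \<Rightarrow> nat list \<Rightarrow> bool" where
  "order_isomorphic s t \<longleftrightarrow> length s = length t \<and>
     (\<forall>i<length s. \<forall>j<length s. s ! i < s ! j \<longleftrightarrow> t ! i < t ! j)"

definition contains_pattern :: "nat list \<Rightarrow> nat list \<Rightarrow> bool" where
  "contains_pattern xs t \<longleftrightarrow> (\<exists>s. subseq s xs \<and> order_isomorphic s t)"

definition avoids :: "nat list \<Rightarrow> nat list \<Rightarrow> bool" where
  "avoids xs t \<longleftrightarrow> \<not> contains_pattern xs t"

definition Av_juxt :: "nat list \<Rightarrow> nat list \<Rightarrow> nat list set" where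
  "Av_juxt a b = {p. is_permutation p \<and> (\<exists>A B. p = A @ B \<and> avoids A a \<and> avoids B b)}"

end

theory Submission imports Defs begin

text \<open>
  A permutation \<open>p\<close> lies in the class of \<open>\<alpha>\<close> juxtaposed with 21 exactly when deleting its longest
  increasing suffix \<open>B\<close> leaves a word \<open>A\<close> that avoids \<open>\<alpha>\<close>, because enlarging the increasing block
  only shortens the other one (\<open>Av_juxt_21_iff\<close>). The decomposition \<open>p = A @ B\<close> is pinned down by
  \<open>B\<close> being increasing and, when \<open>A\<close> is nonempty, \<open>last A # B\<close> not being increasing. This
  condition sees \<open>A\<close> only through its last entry. Hence any bijection \<open>\<phi>\<close> from the 231-avoiding to
  the 321-avoiding words that preserves the set of entries and the last entry induces the required
  map \<open>A @ B \<mapsto> \<phi> A @ B\<close>, inverted by the same construction applied to the inverse of \<open>\<phi>\<close>.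

  Such a \<open>\<phi>\<close> exists because 231 and 321 are equidistributed with respect to the last entry
  (\<open>card_avoids_above_last\<close>). The two patterns have the same shape: a smallest entry at the end,
  preceded by two larger entries that form an ascent or a descent. So a word \<open>w @ [x]\<close> avoids the
  pattern iff \<open>w\<close> does and the entries of \<open>w\<close> above \<open>x\<close> are monotone, decreasing for 231 and
  increasing for 321. Removing last entries repeatedly therefore only ever leads to counting
  pattern-avoiding words over \<open>S\<close> in which a set \<open>T\<close> of largest entries is monotone. Let \<open>x\<close> be
  the last entry of such a word. If \<open>x\<close> lies outside \<open>T\<close>, the entries above \<open>x\<close> take over the
  role of \<open>T\<close>. If it lies in \<open>T\<close>, it must be the last term of the monotone sequence, that is, the
  minimum of \<open>T\<close> for 231 and the maximum for 321, and \<open>T\<close> shrinks by one. In both cases the count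
  obeys the same recursion in the sizes of \<open>S\<close> and \<open>T\<close>, that of the ballot numbers
  (\<open>card_arrangements\<close>).
\<close>

section \<open>Fibrewise bijections\<close>

lemma bij_betw_fibrewise:
  assumes "\<And>k. \<exists>h. bij_betw h {x \<in> X. f x = k} {y \<in> Y. g y = k}"
  shows "\<exists>\<phi>. bij_betw \<phi> X Y \<and> (\<forall>x\<in>X. g (\<phi> x) = f x)"
proof -
  obtain h where h: "\<And>k. bij_betw (h k) {x \<in> X. f x = k} {y \<in> Y. g y = k}"
    using assms by metis
  define \<phi> where "\<phi> x = h (f x) x" for x
  have mem: "\<phi> x \<in> Y \<and> g (\<phi> x) = f x" if "x \<in> X" for x
    using bij_betw_apply[OF h[of "f x"], of x] that by (auto simp: \<phi>_def)
  have "inj_on \<phi> X"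
  proof (rule inj_onI)
    fix x y assume xy: "x \<in> X" "y \<in> X" "\<phi> x = \<phi> y"
    then have "f x = f y" using mem by metis
    then show "x = y"
      using bij_betw_imp_inj_on[OF h[of "f x"]] xy by (auto simp: \<phi>_def inj_on_def)
  qed
  moreover have "y \<in> \<phi> ` X" if "y \<in> Y" for y
  proof -
    have "y \<in> h (g y) ` {x \<in> X. f x = g y}"
      using bij_betw_imp_surj_on[OF h[of "g y"]] that by auto
    then show ?thesis by (force simp: \<phi>_def)
  qed
  ultimately have "bij_betw \<phi> X Y"
    using mem by (auto simp: bij_betw_def)
  then show ?thesis using mem by blast
qed

section \<open>Permutations avoiding 231 or 321, and their last entry\<close>

text \<open>For words with distinct entries, \<open>R = (<)\<close> says that the entries in \<open>T\<close> decrease and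
  \<open>R = (>)\<close> that they increase.\<close>

definition no_pair :: "('a \<Rightarrow> 'a \<Rightarrow> bool) \<Rightarrow> 'a set \<Rightarrow> 'a list \<Rightarrow> bool" where
  "no_pair R T w \<longleftrightarrow> (\<forall>b\<in>T. \<forall>c\<in>T. subseq [b, c] w \<longrightarrow> \<not> R b c)"

text \<open>A common form of the two patterns: \<open>R = (<)\<close> gives 231 and \<open>R = (>)\<close> gives 321.\<close>

definition avoids_above :: "('a::linorder \<Rightarrow> 'a \<Rightarrow> bool) \<Rightarrow> 'a list \<Rightarrow> bool" where
  "avoids_above R w \<longleftrightarrow> (\<forall>a b c. subseq [b, c, a] w \<longrightarrow> a < b \<longrightarrow> a < c \<longrightarrow> \<not> R b c)"

definition arrangements :: "('a::linorder \<Rightarrow> 'a \<Rightarrow> bool) \<Rightarrow> 'a set \<Rightarrow> 'a set \<Rightarrow> 'a list set" where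
  "arrangements R S T = {w \<in> permutations_of_set S. avoids_above R w \<and> no_pair R T w}"

text \<open>These are the ballot numbers: for \<open>1 \<le> t < n\<close> subtracting consecutive equations gives
  \<open>ballot n t = ballot n (t + 1) + ballot (n - 1) (t - 1)\<close>, and \<open>ballot n 1\<close> is the \<open>n\<close>-th Catalan
  number. The lower bound \<open>max 1 t\<close> together with truncated subtraction makes
  \<open>ballot n 0 = ballot n 1\<close>, as befits a condition that is vacuous for sets with at most one
  element.\<close>

fun ballot :: "nat \<Rightarrow> nat \<Rightarrow> nat" where
  "ballot 0 t = 1"
| "ballot (Suc n) t = ballot n (t - 1) + (\<Sum>g = max 1 t..n. ballot n g)"

lemma subseq_snoc_iff:
  "subseq (s @ [a]) (w @ [x]) \<longleftrightarrow> subseq (s @ [a]) w \<or> a = x \<and> subseq s w"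
proof
  assume "subseq (s @ [a]) (w @ [x])"
  then obtain u v where uv: "s @ [a] = u @ v" "subseq u w" "subseq v [x]"
    by (auto simp: subseq_append_iff)
  show "subseq (s @ [a]) w \<or> a = x \<and> subseq s w"
  proof (cases v rule: rev_cases)
    case Nil
    then show ?thesis using uv by simp
  next
    case (snoc v' z)
    then have "length v' = 0" using list_emb_length[OF uv(3)] by simp
    then show ?thesis using uv snoc by (auto split: if_splits)
  qed
next
  assume "subseq (s @ [a]) w \<or> a = x \<and> subseq s w"
  then show "subseq (s @ [a]) (w @ [x])"
    using subseq_rev_drop_many by auto
qed

lemma no_pair_snoc:
  "no_pair R T (w @ [x]) \<longleftrightarrow> no_pair R T w \<and> (x \<in> T \<longrightarrow> (\<forall>b \<in> T \<inter> set w. \<not> R b x))"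
proof -
  have "subseq [b, c] (w @ [x]) \<longleftrightarrow> subseq [b, c] w \<or> c = x \<and> b \<in> set w" for b c
    using subseq_snoc_iff[of "[b]" c w x] by (simp add: subseq_singleton_left)
  then show ?thesis unfolding no_pair_def by blast
qed

lemma avoids_above_snoc:
  "avoids_above R (w @ [x]) \<longleftrightarrow> avoids_above R w \<and> no_pair R {y. x < y} w"
proof -
  have snoc: "subseq [b, c, a] (w @ [x]) \<longleftrightarrow> subseq [b, c, a] w \<or> a = x \<and> subseq [b, c] w"
    for a b c
    using subseq_snoc_iff[of "[b, c]" a w x] by simp
  show ?thesis (is "?l \<longleftrightarrow> ?r")
  proof
    assume l: ?l
    have m: "\<not> R b c" if "subseq [b, c, a] w \<or> a = x \<and> subseq [b, c] w" "a < b" "a < c" for a b c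
      by (rule l[unfolded avoids_above_def snoc, rule_format, OF that])
    have "avoids_above R w" unfolding avoids_above_def using m by blast
    moreover have "no_pair R {y. x < y} w" unfolding no_pair_def using m[where a = x] by simp
    ultimately show ?r ..
  next
    assume r: ?r
    show ?l unfolding avoids_above_def
    proof (intro allI impI)
      fix a b c
      assume "subseq [b, c, a] (w @ [x])" and "a < b" "a < c"
      then show "\<not> R b c" using r unfolding snoc avoids_above_def no_pair_def by auto
    qed
  qed
qed

lemma no_pair_cong:
  assumes "T \<inter> set w = T' \<inter> set w"
  shows "no_pair R T w = no_pair R T' w"
proof -
  have "b \<in> set w \<and> c \<in> set w" if "subseq [b, c] w" for b c
    
  proof
    show "b \<in> set w" by (rule list_emb_set[OF that, of b]) auto
    show "c \<in> set w" by (rule list_emb_set[OF that, of c]) auto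
  qed
  then show ?thesis using assms unfolding no_pair_def by blast
qed

lemma no_pair_mono: "no_pair R T w \<Longrightarrow> T' \<subseteq> T \<Longrightarrow> no_pair R T' w"
  unfolding no_pair_def by blast

lemma snoc_in_permutations_of_set:
  "w @ [x] \<in> permutations_of_set S \<longleftrightarrow> x \<in> S \<and> w \<in> permutations_of_set (S - {x})"
  by (auto simp: permutations_of_set_def)

lemma finite_arrangements: "finite S \<Longrightarrow> finite (arrangements R S T)"
  by (auto simp: arrangements_def)

text \<open>The element \<open>e\<close> is the only one of \<open>T\<close> that may come after all others of \<open>T\<close>. Of the two
  monotonicity conditions that \<open>w\<close> inherits, on \<open>T\<close> and on the entries above \<open>x\<close>, the stronger
  one survives: since \<open>T\<close> is upward closed in \<open>S\<close>, the two sets are nested, and which one contains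
  the other depends on whether \<open>x\<close> belongs to \<open>T\<close>.\<close>

lemma snoc_in_arrangements:
  assumes up: "\<And>x y. x \<in> T \<Longrightarrow> y \<in> S \<Longrightarrow> x < y \<Longrightarrow> y \<in> T"
    and T: "T \<subseteq> S"
    and e: "e \<in> T" "\<And>y. y \<in> T \<Longrightarrow> y \<noteq> e \<Longrightarrow> R e y \<and> \<not> R y e"
  shows "w @ [x] \<in> arrangements R S T \<longleftrightarrow>
    (if x \<in> T then x = e \<and> w \<in> arrangements R (S - {e}) (T - {e})
     else x \<in> S \<and> w \<in> arrangements R (S - {x}) {y \<in> S. x < y})"
proof (cases "x \<in> S \<and> w \<in> permutations_of_set (S - {x})")
  case False
  then show ?thesis using T by (auto simp: arrangements_def snoc_in_permutations_of_set)
next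
  case True
  then have w: "set w = S - {x}" and x: "x \<in> S" by (auto simp: permutations_of_set_def)
  have gt: "no_pair R {y. x < y} w = no_pair R {y \<in> S. x < y} w"
    by (rule no_pair_cong) (use w in auto)
  show ?thesis
  proof (cases "x \<in> T")
    case xT: True
    have 1: "no_pair R T w = no_pair R (T - {x}) w"
      by (rule no_pair_cong) (use w in auto)
    have 2: "no_pair R {y. x < y} w" if "no_pair R (T - {x}) w"
      unfolding gt using that by (rule no_pair_mono) (use up xT in auto)
    have 3: "(\<forall>b \<in> T \<inter> set w. \<not> R b x) \<longleftrightarrow> x = e"
    proof
      assume *: "\<forall>b \<in> T \<inter> set w. \<not> R b x"
      show "x = e"
      proof (rule ccontr)
        assume "x \<noteq> e"
        then have "e \<in> T \<inter> set w" using e(1) T w by auto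
        then show False using * e(2)[OF xT \<open>x \<noteq> e\<close>] by blast
      qed
    next
      assume "x = e"
      then show "\<forall>b \<in> T \<inter> set w. \<not> R b x" using e(2) w by auto
    qed
    have "w @ [x] \<in> arrangements R S T \<longleftrightarrow>
        x = e \<and> avoids_above R w \<and> no_pair R (T - {x}) w"
      unfolding arrangements_def mem_Collect_eq snoc_in_permutations_of_set
        avoids_above_snoc no_pair_snoc 3 1
      using True xT 2 by blast
    then show ?thesis using True xT by (auto simp: arrangements_def)
  next
    case xT: False
    have "T \<subseteq> {y \<in> S. x < y}"
    proof
      fix y assume y: "y \<in> T"
      then have "x \<noteq> y" "\<not> y < x" using up xT x by auto
      then show "y \<in> {y \<in> S. x < y}" using y T by auto
    qed
    then have "no_pair R T w" if "no_pair R {y \<in> S. x < y} w"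
      by (rule no_pair_mono[OF that])
    then have "w @ [x] \<in> arrangements R S T \<longleftrightarrow>
        avoids_above R w \<and> no_pair R {y \<in> S. x < y} w"
      unfolding arrangements_def mem_Collect_eq snoc_in_permutations_of_set
        avoids_above_snoc no_pair_snoc gt
      using True xT by blast
    then show ?thesis using True xT by (auto simp: arrangements_def)
  qed
qed

lemma arrangements_rec:
  assumes up: "\<And>x y. x \<in> T \<Longrightarrow> y \<in> S \<Longrightarrow> x < y \<Longrightarrow> y \<in> T"
    and T: "T \<subseteq> S"
    and e: "e \<in> T" "\<And>y. y \<in> T \<Longrightarrow> y \<noteq> e \<Longrightarrow> R e y \<and> \<not> R y e"
  shows "arrangements R S T = (\<lambda>w. w @ [e]) ` arrangements R (S - {e}) (T - {e})
    \<union> (\<Union>x \<in> S - T. (\<lambda>w. w @ [x]) ` arrangements R (S - {x}) {y \<in> S. x < y})" (is "_ = ?R")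
proof (rule set_eqI)
  fix u
  show "u \<in> arrangements R S T \<longleftrightarrow> u \<in> ?R"
  proof (cases u rule: rev_cases)
    case Nil
    have "[] \<notin> arrangements R S T" using e T by (auto simp: arrangements_def permutations_of_set_def)
    then show ?thesis using Nil by auto
  next
    case (snoc w x)
    show ?thesis unfolding snoc
      by (subst snoc_in_arrangements[where T = T and S = S and e = e and R = R, OF up T e]) (use T e in auto)
  qed
qed

text \<open>Lets a sum over the possible last entries outside \<open>T\<close> be rewritten as a sum over the number
  of entries above the last one, so that only sizes remain in the recursion.\<close>

lemma bij_betw_card_above:
  fixes S :: "'a::linorder set"
  assumes "finite S"
    and up: "\<And>x y. x \<in> T \<Longrightarrow> y \<in> S \<Longrightarrow> x < y \<Longrightarrow> y \<in> T"
    and T: "T \<subseteq> S"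
  shows "bij_betw (\<lambda>x. card {y \<in> S. x < y}) (S - T) {card T..<card S}"
proof -
  let ?f = "\<lambda>x. card {y \<in> S. x < y}"
  have less: "?f y < ?f x" if "x \<in> S" "y \<in> S" "x < y" for x y
    by (rule psubset_card_mono) (use assms(1) that in auto)
  have inj: "inj_on ?f (S - T)"
  proof (rule inj_onI, rule ccontr)
    fix x y assume xy: "x \<in> S - T" "y \<in> S - T" "?f x = ?f y" "x \<noteq> y"
    then consider "x < y" | "y < x" by (rule_tac linorder_neqE) auto
    then show False using less[of x y] less[of y x] xy by cases auto
  qed
  have "?f x \<in> {card T..<card S}" if "x \<in> S - T" for x
  proof -
    have "T \<subseteq> {y \<in> S. x < y}"
    proof
      fix y assume y: "y \<in> T"
      then have "x \<noteq> y" "\<not> y < x" using up that by auto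
      then show "y \<in> {y \<in> S. x < y}" using y T by auto
    qed
    then have "card T \<le> ?f x" using assms(1) by (intro card_mono) auto
    moreover have "?f x < card S" by (rule psubset_card_mono) (use assms(1) that in auto)
    ultimately show ?thesis by simp
  qed
  then have "?f ` (S - T) \<subseteq> {card T..<card S}" by blast
  moreover have "card (?f ` (S - T)) = card {card T..<card S}"
    using inj T assms(1) by (simp add: card_image card_Diff_subset finite_subset)
  ultimately have "?f ` (S - T) = {card T..<card S}"
    by (intro card_subset_eq) auto
  with inj show ?thesis by (simp add: bij_betw_def)
qed

text \<open>Both choices of \<open>R\<close> give the same count because the recursion of \<open>arrangements_rec\<close> depends
  on \<open>R\<close> only through the choice of \<open>e\<close>, and the choice of \<open>e\<close> does not affect cardinalities.\<close>

lemma card_arrangements: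
  fixes S :: "'a::linorder set"
  assumes R: "R = (<) \<or> R = (>)"
    and "finite S" "T \<subseteq> S"
    and "\<And>x y. x \<in> T \<Longrightarrow> y \<in> S \<Longrightarrow> x < y \<Longrightarrow> y \<in> T"
  shows "card (arrangements R S T) = ballot (card S) (card T)"
  using assms(2-)
proof (induction "card S" arbitrary: S T)
  case 0
  then have "S = {}" by simp
  then have "arrangements R S T = {[]}"
    by (auto simp: arrangements_def avoids_above_def no_pair_def)
  then show ?case using \<open>S = {}\<close> by simp
next
  case (Suc n)
  have main: "card (arrangements R S U) = ballot (Suc n) (card U)"
    if U: "U \<subseteq> S" "U \<noteq> {}" and up: "\<And>x y. x \<in> U \<Longrightarrow> y \<in> S \<Longrightarrow> x < y \<Longrightarrow> y \<in> U" for U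
  proof -
    have fU: "finite U" using U Suc.prems finite_subset by blast
    define e where "e = (if R = (<) then Min U else Max U)"
    have e: "e \<in> U" using fU U by (auto simp: e_def)
    have e': "R e y \<and> \<not> R y e" if "y \<in> U" "y \<noteq> e" for y
    proof (cases "R = (<)")
      case True
      then have "e < y" using that Min_le[OF fU that(1)] by (simp add: e_def)
      then show ?thesis using True by auto
    next
      case False
      then have "y < e" using that Max_ge[OF fU that(1)] by (simp add: e_def)
      then show ?thesis using False R by auto
    qed
    let ?A = "\<lambda>x. arrangements R (S - {x}) {y \<in> S. x < y}"
    have c1: "card (arrangements R (S - {e}) (U - {e})) = ballot n (card U - 1)"
    proof -
      have "n = card (S - {e})" using Suc.hyps(2) Suc.prems(1) e U
        by (metis card_Diff_singleton diff_Suc_1 subsetD)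
      from Suc.hyps(1)[OF this, of "U - {e}"] this show ?thesis
        using Suc.prems(1) U up e by (auto simp: card_Diff_singleton)
    qed
    have c2: "card (?A x) = ballot n (card {y \<in> S. x < y})" if "x \<in> S - U" for x
    proof -
      have n: "n = card (S - {x})" using Suc.hyps(2) Suc.prems(1) that
        by (metis card_Diff_singleton diff_Suc_1 DiffD1)
      show ?thesis unfolding n by (rule Suc.hyps(1)[OF n]) (use Suc.prems(1) in auto)
    qed
    have fin: "finite (arrangements R (S - {x}) V)" for x V
      using Suc.prems(1) by (simp add: finite_arrangements)
    have cU: "card U \<ge> 1" using fU U by (simp add: Suc_leI card_gt_0_iff)
    have "card (arrangements R S U)
        = card ((\<lambda>w. w @ [e]) ` arrangements R (S - {e}) (U - {e}))
          + card (\<Union>x \<in> S - U. (\<lambda>w. w @ [x]) ` ?A x)"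
      by (subst arrangements_rec[where T = U and S = S and e = e and R = R, OF up U(1) e e'])
        (assumption+, rule card_Un_disjoint, use fin e Suc.prems(1) in auto)
    also have "card ((\<lambda>w. w @ [e]) ` arrangements R (S - {e}) (U - {e}))
        = ballot n (card U - 1)"
      using c1 by (simp add: card_image inj_on_def)
    also have "card (\<Union>x \<in> S - U. (\<lambda>w. w @ [x]) ` ?A x)
        = (\<Sum>x \<in> S - U. card ((\<lambda>w. w @ [x]) ` ?A x))"
      by (rule card_UN_disjoint) (use fin Suc.prems(1) in auto)
    also have "\<dots> = (\<Sum>x \<in> S - U. ballot n (card {y \<in> S. x < y}))"
      using c2 by (intro sum.cong refl) (simp add: card_image inj_on_def)
    also have "\<dots> = (\<Sum>g \<in> {card U..<card S}. ballot n g)"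
      by (rule sum.reindex_bij_betw[OF bij_betw_card_above[where S = S and T = U, OF Suc.prems(1) up U(1)]])
    also have "{card U..<card S} = {max 1 (card U)..n}"
      using cU Suc.hyps(2) by auto
    finally show ?thesis by simp
  qed
  show ?case
  proof (cases "T = {}")
    case False
    then show ?thesis using main[OF Suc.prems(2) False Suc.prems(3)] Suc.hyps(2) by simp
  next
    case True
    have "S \<noteq> {}" using Suc.hyps(2) by auto
    then have M: "Max S \<in> S" using Suc.prems(1) by simp
    \<comment> \<open>A condition on a one-element set is as vacuous as one on the empty set, and this reduces the
      case to nonempty sets, which contain a suitable \<open>e\<close>.\<close>
    have "no_pair R {Max S} w" if "w \<in> permutations_of_set S" for w
      using R by (auto simp: no_pair_def)
    then have "arrangements R S {} = arrangements R S {Max S}"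
      by (auto simp: arrangements_def no_pair_def)
    moreover have "card (arrangements R S {Max S}) = ballot (Suc n) 1"
      using main[of "{Max S}"] M Max_ge[OF Suc.prems(1)] by (simp add: leD)
    ultimately show ?thesis using True Suc.hyps(2)[symmetric] by simp
  qed
qed

lemma card_avoids_above_last:
  fixes S :: "'a::linorder set"
  assumes R: "R = (<) \<or> R = (>)" and S: "finite S" "x \<in> S"
  shows "card {w \<in> permutations_of_set S. avoids_above R w \<and> last w = x}
    = ballot (card S - 1) (card {y \<in> S. x < y})"
proof -
  have "{w \<in> permutations_of_set S. avoids_above R w \<and> last w = x}
      = (\<lambda>w. w @ [x]) ` arrangements R (S - {x}) {y \<in> S. x < y}" (is "?L = ?R")
  proof (rule set_eqI)
    fix u show "u \<in> ?L \<longleftrightarrow> u \<in> ?R"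
    proof (cases u rule: rev_cases)
      case Nil
      then show ?thesis using S by (auto simp: permutations_of_set_def)
    next
      case (snoc w z)
      have "no_pair R {y. x < y} w = no_pair R {y \<in> S. x < y} w"
        if "w \<in> permutations_of_set (S - {x})"
        by (rule no_pair_cong) (use that in \<open>auto simp: permutations_of_set_def\<close>)
      then show ?thesis unfolding snoc using S
        by (auto simp: arrangements_def snoc_in_permutations_of_set avoids_above_snoc)
    qed
  qed
  then have "card {w \<in> permutations_of_set S. avoids_above R w \<and> last w = x}
      = card (arrangements R (S - {x}) {y \<in> S. x < y})"
    by (simp add: card_image inj_on_def)
  also have "\<dots> = ballot (card (S - {x})) (card {y \<in> S. x < y})"
    by (rule card_arrangements[OF R]) (use S in auto)
  finally show ?thesis using S by simp
qed

text \<open>The words are grouped by entry set and last entry, and corresponding groups have equal size.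
  The empty word, whose last entry is a fixed unspecified value, is alone in its group on both
  sides.\<close>

lemma bij_avoids_above_same_last:
  "\<exists>\<phi>. bij_betw \<phi> {w :: 'a::linorder list. distinct w \<and> avoids_above (<) w}
                    {w. distinct w \<and> avoids_above (>) w} \<and>
       (\<forall>w. distinct w \<and> avoids_above (<) w \<longrightarrow> set (\<phi> w) = set w \<and> last (\<phi> w) = last w)"
proof -
  let ?key = "\<lambda>w :: 'a list. (set w, last w)"
  let ?X = "\<lambda>R. {w :: 'a list. distinct w \<and> avoids_above R w}"
  have "\<exists>h. bij_betw h {w \<in> ?X (<). ?key w = k} {w \<in> ?X (>). ?key w = k}" for k
  proof -
    obtain S x where k: "k = (S, x)" by fastforce
    have fib: "{w \<in> ?X R. ?key w = k}
        = {w \<in> permutations_of_set S. avoids_above R w \<and> last w = x}" for R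
      by (auto simp: k permutations_of_set_def)
    consider "infinite S" | "S = {}" | "finite S" "S \<noteq> {}" "x \<notin> S" | "finite S" "x \<in> S"
      by blast
    then have "card {w \<in> ?X (<). ?key w = k} = card {w \<in> ?X (>). ?key w = k}"
    proof cases
      case 1
      then show ?thesis unfolding fib by (simp add: permutations_of_set_infinite)
    next
      case 2
      have "avoids_above R []" for R :: "'a \<Rightarrow> 'a \<Rightarrow> bool" by (auto simp: avoids_above_def)
      then show ?thesis unfolding fib 2 by (intro arg_cong[where f = card]) auto
    next
      case 3
      then have "last w \<noteq> x" if "w \<in> permutations_of_set S" for w
        using that last_in_set[of w] by (auto simp: permutations_of_set_def)
      then have none: "{w \<in> permutations_of_set S. avoids_above R w \<and> last w = x} = {}" for R
        by blast
      show ?thesis by (simp only: fib none)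
    next
      case 4
      then show ?thesis unfolding fib by (simp add: card_avoids_above_last)
    qed
    moreover have "finite {w \<in> ?X R. ?key w = k}" for R
      unfolding fib by simp
    ultimately show ?thesis by (intro finite_same_card_bij)
  qed
  from bij_betw_fibrewise[of "?X (<)" ?key "?X (>)" ?key, OF this] show ?thesis by auto
qed

section \<open>The longest increasing suffix\<close>

fun inc_suffix :: "'a::linorder list \<Rightarrow> 'a list" where
  "inc_suffix [] = []"
| "inc_suffix (x # xs) = (if sorted (x # xs) then x # xs else inc_suffix xs)"

fun inc_prefix :: "'a::linorder list \<Rightarrow> 'a list" where
  "inc_prefix [] = []"
| "inc_prefix (x # xs) = (if sorted (x # xs) then [] else x # inc_prefix xs)"

lemma inc_prefix_suffix: "inc_prefix p @ inc_suffix p = p"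
  by (induction p) auto

lemma sorted_inc_suffix: "sorted (inc_suffix p)"
  by (induction p) auto

lemma inc_suffix_maximal:
  "inc_prefix p \<noteq> [] \<Longrightarrow> \<not> sorted (last (inc_prefix p) # inc_suffix p)"
proof (induction p)
  case (Cons x xs)
  show ?case
  proof (cases "inc_prefix xs = []")
    case True
    then have "inc_suffix xs = xs" using inc_prefix_suffix[of xs] by simp
    then show ?thesis using Cons True by (auto split: if_splits)
  next
    case False
    then show ?thesis using Cons by (auto split: if_splits)
  qed
qed simp

text \<open>The hypothesis involves \<open>A\<close> only through its last entry and whether it is empty. This is why
  the prefix can be exchanged for another one with the same last entry.\<close>

lemma inc_decomposition_unique:
  assumes "sorted B" "A \<noteq> [] \<Longrightarrow> \<not> sorted (last A # B)"
  shows "inc_prefix (A @ B) = A \<and> inc_suffix (A @ B) = B"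
  using assms
proof (induction A)
  case Nil
  then show ?case by (cases B) auto
next
  case (Cons x A)
  have "\<not> sorted (x # A @ B)"
  proof
    assume "sorted (x # A @ B)"
    then have "sorted (butlast (x # A) @ last (x # A) # B)"
      by (metis append_Cons append_butlast_last_id append.assoc append_Nil list.distinct(1))
    then show False using Cons.prems(2) by (simp add: sorted_append)
  qed
  moreover have "inc_prefix (A @ B) = A \<and> inc_suffix (A @ B) = B"
    by (rule Cons.IH) (use Cons.prems in \<open>auto split: if_splits\<close>)
  ultimately show ?case by simp
qed

text \<open>Every decomposition with an increasing second block extends the canonical first block, so an
  avoidance condition on the first block is weakest for the canonical decomposition.\<close>

lemma inc_prefix_least:
  "sorted B \<Longrightarrow> \<exists>C. A = inc_prefix (A @ B) @ C"
proof (induction A)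
  case Nil
  then show ?case by (cases B) auto
qed auto

section \<open>Patterns and juxtaposition classes\<close>

lemma avoids_231_iff: "avoids w [2, 3, 1] \<longleftrightarrow> avoids_above (<) w"
proof -
  have iso: "order_isomorphic s [2, 3, 1] \<longleftrightarrow> (\<exists>a b c. s = [b, c, a] \<and> a < b \<and> a < c \<and> b < c)" for s
  proof (cases "\<exists>a b c. s = [b, c, a]")
    case True
    then show ?thesis by (elim exE) (auto simp: order_isomorphic_def All_less_Suc)
  next
    case False
    then have "length s \<noteq> 3" by (auto simp: length_Suc_conv numeral_3_eq_3)
    then show ?thesis using False by (auto simp: order_isomorphic_def)
  qed
  have "contains_pattern w [2, 3, 1] \<longleftrightarrow> (\<exists>a b c. subseq [b, c, a] w \<and> a < b \<and> a < c \<and> b < c)"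
    unfolding contains_pattern_def iso by blast
  then show ?thesis unfolding avoids_def avoids_above_def by blast
qed

lemma avoids_321_iff: "avoids w [3, 2, 1] \<longleftrightarrow> avoids_above (>) w"
proof -
  have iso: "order_isomorphic s [3, 2, 1] \<longleftrightarrow> (\<exists>a b c. s = [b, c, a] \<and> a < b \<and> a < c \<and> b > c)" for s
  proof (cases "\<exists>a b c. s = [b, c, a]")
    case True
    then show ?thesis by (elim exE) (auto simp: order_isomorphic_def All_less_Suc)
  next
    case False
    then have "length s \<noteq> 3" by (auto simp: length_Suc_conv numeral_3_eq_3)
    then show ?thesis using False by (auto simp: order_isomorphic_def)
  qed
  have "contains_pattern w [3, 2, 1] \<longleftrightarrow> (\<exists>a b c. subseq [b, c, a] w \<and> a < b \<and> a < c \<and> b > c)"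
    unfolding contains_pattern_def iso by blast
  then show ?thesis unfolding avoids_def avoids_above_def by blast
qed

lemma avoids_21_iff: "avoids w [2, 1] \<longleftrightarrow> sorted w"
proof -
  have iso: "order_isomorphic s [2, 1] \<longleftrightarrow> (\<exists>b c. s = [b, c] \<and> c < b)" for s
  proof (cases "\<exists>b c. s = [b, c]")
    case True
    then show ?thesis by (elim exE) (auto simp: order_isomorphic_def All_less_Suc)
  next
    case False
    then have "length s \<noteq> 2" by (auto simp: length_Suc_conv numeral_2_eq_2)
    then show ?thesis using False by (auto simp: order_isomorphic_def)
  qed
  have "avoids w [2, 1] \<longleftrightarrow> (\<forall>b c. subseq [b, c] w \<longrightarrow> b \<le> c)"
    unfolding avoids_def contains_pattern_def iso not_less[symmetric] by blast
  also have "\<dots> \<longleftrightarrow> sorted w"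
  proof (induction w)
    case (Cons x w)
    have split: "subseq [b, c] (x # w) \<longleftrightarrow> b = x \<and> c \<in> set w \<or> subseq [b, c] w" for b c
      using subseq_Cons'[of b "[c]" w] by (auto simp: subseq_singleton_left)
    have "(\<forall>b c. subseq [b, c] (x # w) \<longrightarrow> b \<le> c) \<longleftrightarrow>
        (\<forall>c \<in> set w. x \<le> c) \<and> (\<forall>b c. subseq [b, c] w \<longrightarrow> b \<le> c)"
      unfolding split by blast
    then show ?case using Cons by simp
  qed simp
  finally show ?thesis .
qed

lemma avoids_prefix: "avoids (A @ C) t \<Longrightarrow> avoids A t"
  unfolding avoids_def contains_pattern_def
  by (meson subseq_order.trans subseq_rev_drop_many subseq_order.refl)

lemma Av_juxt_21_iff:
  "p \<in> Av_juxt a [2, 1] \<longleftrightarrow> is_permutation p \<and> avoids (inc_prefix p) a"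
proof -
  have "(\<exists>A B. p = A @ B \<and> avoids A a \<and> sorted B) \<longleftrightarrow> avoids (inc_prefix p) a"
  proof
    assume "\<exists>A B. p = A @ B \<and> avoids A a \<and> sorted B"
    then obtain A B where p: "p = A @ B" "avoids A a" "sorted B" by blast
    then obtain C where "A = inc_prefix p @ C" using inc_prefix_least by blast
    then show "avoids (inc_prefix p) a" using p(2) avoids_prefix by metis
  next
    assume "avoids (inc_prefix p) a"
    then show "\<exists>A B. p = A @ B \<and> avoids A a \<and> sorted B"
      using inc_prefix_suffix[of p, symmetric] sorted_inc_suffix[of p] by blast
  qed
  then show ?thesis unfolding Av_juxt_def avoids_21_iff by blast
qed

lemma is_permutation_iff: "is_permutation p \<longleftrightarrow> distinct p \<and> set p = {1..length p}"
  by (auto simp: is_permutation_def permutations_of_set_def)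

text \<open>The set of entries being preserved keeps the word a permutation, and the last entry being
  preserved keeps the longest increasing suffix from growing into the new prefix.\<close>

lemma replace_inc_prefix:
  assumes p: "is_permutation p"
    and A: "distinct A" "set A = set (inc_prefix p)" "last A = last (inc_prefix p)"
  shows "is_permutation (A @ inc_suffix p)" "length (A @ inc_suffix p) = length p"
    "inc_prefix (A @ inc_suffix p) = A" "inc_suffix (A @ inc_suffix p) = inc_suffix p"
proof -
  note dec = inc_prefix_suffix[of p]
  have d: "distinct (inc_prefix p @ inc_suffix p)" using p dec by (simp add: is_permutation_iff)
  then have "length A = length (inc_prefix p)"
    using A by (metis distinct_append distinct_card)
  then show len: "length (A @ inc_suffix p) = length p"
    using dec by (metis length_append)
  have "set (A @ inc_suffix p) = set p" using A dec by (metis set_append)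
  moreover have "distinct (A @ inc_suffix p)" using A d by simp
  ultimately show "is_permutation (A @ inc_suffix p)"
    using p len by (simp add: is_permutation_iff)
  have "A \<noteq> [] \<Longrightarrow> \<not> sorted (last A # inc_suffix p)"
    using A inc_suffix_maximal[of p] by fastforce
  from inc_decomposition_unique[OF sorted_inc_suffix this]
  show "inc_prefix (A @ inc_suffix p) = A" "inc_suffix (A @ inc_suffix p) = inc_suffix p"
    by auto
qed

theorem theorem5:
  "\<exists>\<psi> :: nat list \<Rightarrow> nat list.
     bij_betw \<psi> (Av_juxt [2, 3, 1] [2, 1]) (Av_juxt [3, 2, 1] [2, 1]) \<and>
     (\<forall>p \<in> Av_juxt [2, 3, 1] [2, 1]. length (\<psi> p) = length p)"
proof -
  let ?X = "{w :: nat list. distinct w \<and> avoids_above (<) w}"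
  let ?Y = "{w :: nat list. distinct w \<and> avoids_above (>) w}"
  obtain \<phi> where bij: "bij_betw \<phi> ?X ?Y"
    and keep: "\<And>w. w \<in> ?X \<Longrightarrow> set (\<phi> w) = set w \<and> last (\<phi> w) = last w"
    using bij_avoids_above_same_last[where 'a = nat] by auto
  define \<phi>' where "\<phi>' = inv_into ?X \<phi>"
  have bij': "bij_betw \<phi>' ?Y ?X" unfolding \<phi>'_def by (rule bij_betw_inv_into[OF bij])
  have inv: "\<phi>' (\<phi> w) = w" if "w \<in> ?X" for w
    unfolding \<phi>'_def by (rule bij_betw_inv_into_left[OF bij that])
  have inv': "\<phi> (\<phi>' w) = w" if "w \<in> ?Y" for w
    unfolding \<phi>'_def by (rule bij_betw_inv_into_right[OF bij that])
  have keep': "set (\<phi>' w) = set w \<and> last (\<phi>' w) = last w" if "w \<in> ?Y" for w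
    using keep[OF bij_betw_apply[OF bij' that]] inv'[OF that] by simp
  define \<psi> where "\<psi> p = \<phi> (inc_prefix p) @ inc_suffix p" for p
  define \<psi>' where "\<psi>' p = \<phi>' (inc_prefix p) @ inc_suffix p" for p
  have dist: "distinct (inc_prefix p)" if "is_permutation p" for p
    using that inc_prefix_suffix[of p] by (metis distinct_append is_permutation_iff)
  have dom: "p \<in> Av_juxt [2, 3, 1] [2, 1] \<longleftrightarrow> is_permutation p \<and> inc_prefix p \<in> ?X" for p
    using dist by (auto simp only: Av_juxt_21_iff avoids_231_iff mem_Collect_eq)
  have ran: "p \<in> Av_juxt [3, 2, 1] [2, 1] \<longleftrightarrow> is_permutation p \<and> inc_prefix p \<in> ?Y" for p
    using dist by (auto simp only: Av_juxt_21_iff avoids_321_iff mem_Collect_eq)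
  have fwd: "\<psi> p \<in> Av_juxt [3, 2, 1] [2, 1] \<and> \<psi>' (\<psi> p) = p \<and> length (\<psi> p) = length p"
    if "p \<in> Av_juxt [2, 3, 1] [2, 1]" for p
  proof -
    from that have p: "is_permutation p" "inc_prefix p \<in> ?X" unfolding dom by blast+
    have Y: "\<phi> (inc_prefix p) \<in> ?Y" using bij_betw_apply[OF bij p(2)] .
    note r = replace_inc_prefix[OF p(1), of "\<phi> (inc_prefix p)", folded \<psi>_def]
    show ?thesis
      using r Y keep[OF p(2)] inv[OF p(2)] inc_prefix_suffix[of p] unfolding ran \<psi>'_def by simp
  qed
  have bwd: "\<psi>' p \<in> Av_juxt [2, 3, 1] [2, 1] \<and> \<psi> (\<psi>' p) = p"
    if "p \<in> Av_juxt [3, 2, 1] [2, 1]" for p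
  proof -
    from that have p: "is_permutation p" "inc_prefix p \<in> ?Y" unfolding ran by blast+
    have X: "\<phi>' (inc_prefix p) \<in> ?X" using bij_betw_apply[OF bij' p(2)] .
    note r = replace_inc_prefix[OF p(1), of "\<phi>' (inc_prefix p)", folded \<psi>'_def]
    show ?thesis
      using r X keep'[OF p(2)] inv'[OF p(2)] inc_prefix_suffix[of p] unfolding dom \<psi>_def by simp
  qed
  have "bij_betw \<psi> (Av_juxt [2, 3, 1] [2, 1]) (Av_juxt [3, 2, 1] [2, 1])"
    by (rule bij_betw_byWitness[where f' = \<psi>']) (use fwd bwd in auto)
  then show ?thesis using fwd by blast
qed

end
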